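(* The set of all oracles, with addition $\alpha+\beta$ and multiplication $\alpha*\beta$ of oracles induced from rational interval arithmetic, is a field.
   Context: For rationals $a,b$, $a:b$ denotes the set of rationals between $a$ and $b$ inclusive, regardless of order (so $a:b=b:a$; $a=b$ is allowed, and $a:a$ is called a singleton). These sets are called rational intervals. A rule is a function $R$ from rational intervals to $\{0,1\}$; an interval is $R$-Yes if $R(a:b)=1$ and $R$-No if $R(a:b)=0$. An oracle is a rule $R$ such that (all letters $a,b,c,d$ rational): (1) Consistency: if $c:d$ contains $a:b$ and $R(a:b)=1$, then $R(c:d)=1$. (2) Existence: $R(a:b)=1$ for some $a:b$. (3) Separating: if $R(a:b)=1$ and $c\in a:b$ with $c\neq a,b$, then $R(c:c)=1$ or $R(a:c)\neq R(c:b)$. (4) Rooted: there is at most one $c$ with $R(c:c)=1$. (5) Closed: if $c$ is contained in all $R$-Yes intervals, then $R(c:c)=1$. Two oracles are equal iff they agree on all rational intervals. Interval arithmetic, for $a\le b$ and $c\le d$: $a:b\oplus c:d=(a+c):(b+d)$ and $a:b\otimes c:d=\min(ac,ad,bc,bd):\max(ac,ad,bc,bd)$. A fonsi is a set of pairwise intersecting rational intervals that contains, for every rational $q>0$, an interval of length less than $q$. For each fonsi there is a unique oracle for which all elements of the fonsi are Yes intervals (the associated oracle). For oracles $\alpha,\beta$, the families $\{A\oplus B\}$ and $\{A\otimes B\}$, with $A$ ranging over $\alpha$-Yes intervals and $B$ over $\beta$-Yes intervals, are fonsis; $\alpha+\beta$ and $\alpha*\beta$ are defined to be the respective associated oracles.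 *)

theory Defs
  imports "HOL-Library.Interval" "HOL-Algebra.Ring"
begin

text \<open>
  The nonempty closed intervals of rationals are the type \<^typ>\<open>rat interval\<close> of the library,
  on which equality is equality of the underlying sets (\<open>interval_eq_set_of_iff\<close>).
  Its addition and multiplication are the interval arithmetic required here: see
  \<open>lower_plus\<close>, \<open>upper_plus\<close>, \<open>lower_times\<close> and \<open>upper_times\<close>.
\<close>

text \<open>The interval \<open>a:b\<close>, in which the order of the end points does not matter.\<close>

definition between :: "rat \<Rightarrow> rat \<Rightarrow> rat interval"
  where "between a b = Interval (min a b, max a b)"

lemma lower_between [simp]: "lower (between a b) = min a b"
  by (simp add: between_def lower.rep_eq Interval_inverse)

lemma upper_between [simp]: "upper (between a b) = max a b"
  by (simp add: between_def upper.rep_eq Interval_inverse)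

lemma set_of_between: "set_of (between a b) = {min a b..max a b}"
  by (simp add: set_of_eq)

lemma between_surj: "\<exists>a b. I = between a b"
  by (intro exI[of _ "lower I"] exI[of _ "upper I"])
     (simp add: interval_eq_iff min_absorb1 max_absorb2)

text \<open>A rule is a function to \<^typ>\<open>bool\<close>; \<^term>\<open>True\<close> stands for the value 1 (Yes).\<close>

type_synonym rule = "rat interval \<Rightarrow> bool"

definition is_oracle :: "rule \<Rightarrow> bool"
  where "is_oracle R \<longleftrightarrow>
    \<comment> \<open>Consistency\<close>
    (\<forall>a b c d. set_of (between a b) \<subseteq> set_of (between c d) \<longrightarrow>
        R (between a b) \<longrightarrow> R (between c d)) \<and>
    \<comment> \<open>Existence\<close>
    (\<exists>a b. R (between a b)) \<and>
    \<comment> \<open>Separating\<close>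
    (\<forall>a b c. R (between a b) \<longrightarrow> c \<in> set_of (between a b) \<longrightarrow> c \<noteq> a \<longrightarrow> c \<noteq> b \<longrightarrow>
        R (between c c) \<or> R (between a c) \<noteq> R (between c b)) \<and>
    \<comment> \<open>Rooted\<close>
    (\<forall>c d. R (between c c) \<longrightarrow> R (between d d) \<longrightarrow> c = d) \<and>
    \<comment> \<open>Closed\<close>
    (\<forall>c. (\<forall>a b. R (between a b) \<longrightarrow> c \<in> set_of (between a b)) \<longrightarrow> R (between c c))"

definition is_fonsi :: "rat interval set \<Rightarrow> bool"
  where "is_fonsi F \<longleftrightarrow>
    (\<forall>A\<in>F. \<forall>B\<in>F. set_of A \<inter> set_of B \<noteq> {}) \<and>
    (\<forall>q>0. \<exists>A\<in>F. width A < q)"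

text \<open>
  The unique oracle for which all elements of a fonsi are Yes intervals.
  The value is unspecified if \<open>F\<close> is not a fonsi.
\<close>

definition associated_oracle :: "rat interval set \<Rightarrow> rule"
  where "associated_oracle F = (THE R. is_fonsi F \<and> is_oracle R \<and> (\<forall>A\<in>F. R A))"

definition oracle_add :: "rule \<Rightarrow> rule \<Rightarrow> rule"
  where "oracle_add \<alpha> \<beta> = associated_oracle {A + B | A B. \<alpha> A \<and> \<beta> B}"

definition oracle_mult :: "rule \<Rightarrow> rule \<Rightarrow> rule"
  where "oracle_mult \<alpha> \<beta> = associated_oracle {A * B | A B. \<alpha> A \<and> \<beta> B}"

text \<open>The oracle of a rational number \<open>q\<close>: the Yes intervals are those that contain \<open>q\<close>.\<close>

definition oracle_of_rat :: "rat \<Rightarrow> rule"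
  where "oracle_of_rat q = (\<lambda>I. q \<in> set_of I)"

lemma is_oracle_oracle_of_rat: "is_oracle (oracle_of_rat q)"
proof -
  have closed: "c = q" if "\<forall>a b. q \<in> set_of (between a b) \<longrightarrow> c \<in> set_of (between a b)" for c
    using that[rule_format, of q q] by (simp add: set_of_between)
  show ?thesis
    unfolding is_oracle_def oracle_of_rat_def
  proof (intro conjI)
    show "\<forall>c. (\<forall>a b. q \<in> set_of (between a b) \<longrightarrow> c \<in> set_of (between a b)) \<longrightarrow>
        q \<in> set_of (between c c)"
      using closed by (auto simp: set_of_between)
  qed (auto simp: set_of_between min_def max_def split: if_splits)
qed

text \<open>
  Addition and multiplication determine the neutral elements: they can only be the oracles of 0 and 1.
\<close>

definition oracle_ring :: "rule ring"
  where "oracle_ring =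
    \<lparr>carrier = {R. is_oracle R}, mult = oracle_mult, one = oracle_of_rat 1,
     zero = oracle_of_rat 0, add = oracle_add\<rparr>"

end

(* Every Yes interval of an oracle contains one common real number, and conversely every rational
   interval containing that real is a Yes interval. Oracles are therefore the same thing as real
   numbers. Interval arithmetic encloses the results of real arithmetic and is continuous in the
   widths, so oracle arithmetic corresponds to real arithmetic and the field structure carries
   over. *)

theory Submission
  imports Defs "HOL-Algebra.QuotRing" "HOL-Algebra.Algebraic_Closure_Type"
begin

section \<open>Rational intervals embedded in the real intervals\<close>

definition real_interval :: "rat interval \<Rightarrow> real interval"
  where "real_interval A = Interval (of_rat (lower A), of_rat (upper A))"

lemma bounds_of_real_interval:
  "bounds_of_interval (real_interval A) = (of_rat (lower A), of_rat (upper A))"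
  by (simp add: real_interval_def Interval_inverse of_rat_less_eq)

lemma lower_real_interval [simp]: "lower (real_interval A) = of_rat (lower A)"
  by (simp add: lower.rep_eq[of "real_interval A"] bounds_of_real_interval)

lemma upper_real_interval [simp]: "upper (real_interval A) = of_rat (upper A)"
  by (simp add: upper.rep_eq[of "real_interval A"] bounds_of_real_interval)

lemma mem_real_interval:
  "x \<in>\<^sub>i real_interval A \<longleftrightarrow> of_rat (lower A) \<le> x \<and> x \<le> of_rat (upper A)"
  by (simp add: set_of_eq)

lemma of_rat_mem_real_interval: "of_rat c \<in>\<^sub>i real_interval A \<longleftrightarrow> c \<in>\<^sub>i A"
  by (simp add: mem_real_interval set_of_eq of_rat_less_eq)

lemma width_real_interval: "width (real_interval A) = of_rat (width A)"
  by (simp add: width_def of_rat_diff)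

lemma mono_of_rat: "mono (of_rat :: rat \<Rightarrow> real)"
  by (simp add: mono_def of_rat_less_eq)

lemma real_interval_plus: "real_interval (A + B) = real_interval A + real_interval B"
  by (simp add: interval_eq_iff of_rat_add)

text \<open>The end points of a product are extrema of products of end points, and the monotone
  embedding commutes with \<open>min\<close> and \<open>max\<close>.\<close>

lemma real_interval_times: "real_interval (A * B) = real_interval A * real_interval B"
  by (simp add: interval_eq_iff lower_times upper_times of_rat_mult
      min_of_mono[OF mono_of_rat, symmetric] max_of_mono[OF mono_of_rat, symmetric])

lemma abs_diff_le_width:
  fixes u v :: real
  assumes "u \<in>\<^sub>i I" "v \<in>\<^sub>i I"
  shows "\<bar>u - v\<bar> \<le> width I"
  using assms by (auto simp: set_of_eq width_def)

text \<open>Both end points of the product are products of points of the factors,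
  \<open>u * v\<close> and \<open>u' * v'\<close>. Their difference splits as
  \<open>u * (v - v') + v' * (u - u')\<close>, and the known points \<open>x\<close> and
  \<open>y\<close> bound the sizes of \<open>u\<close> and \<open>v'\<close>. With \<open>x\<close>
  and \<open>y\<close> fixed, the bound tends to 0 with the widths.\<close>

lemma width_times_le:
  fixes I J :: "real interval"
  assumes "x \<in>\<^sub>i I" "y \<in>\<^sub>i J"
  shows "width (I * J) \<le> (\<bar>x\<bar> + width I) * width J + (\<bar>y\<bar> + width J) * width I"
proof -
  have "upper (I * J) \<in>\<^sub>i I * J" "lower (I * J) \<in>\<^sub>i I * J"
    by (simp_all add: set_of_eq)
  then obtain u v u' v' where uv: "upper (I * J) = u * v" "u \<in>\<^sub>i I" "v \<in>\<^sub>i J"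
    and uv': "lower (I * J) = u' * v'" "u' \<in>\<^sub>i I" "v' \<in>\<^sub>i J"
    by (metis times_in_intervalE)
  have "\<bar>u\<bar> \<le> \<bar>x\<bar> + width I" "\<bar>v'\<bar> \<le> \<bar>y\<bar> + width J"
    using abs_diff_le_width[OF uv(2) assms(1)] abs_diff_le_width[OF uv'(3) assms(2)] by linarith+
  moreover have "\<bar>u - u'\<bar> \<le> width I" "\<bar>v - v'\<bar> \<le> width J"
    using abs_diff_le_width uv uv' by blast+
  ultimately have "\<bar>u\<bar> * \<bar>v - v'\<bar> + \<bar>v'\<bar> * \<bar>u - u'\<bar>
      \<le> (\<bar>x\<bar> + width I) * width J + (\<bar>y\<bar> + width J) * width I"
    by (intro add_mono mult_mono) linarith+
  moreover have "u * v - u' * v' = u * (v - v') + v' * (u - u')"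
    by (simp add: algebra_simps)
  then have "u * v - u' * v' \<le> \<bar>u\<bar> * \<bar>v - v'\<bar> + \<bar>v'\<bar> * \<bar>u - u'\<bar>"
    using add_mono[OF abs_ge_self[of "u * (v - v')"] abs_ge_self[of "v' * (u - u')"]]
    by (simp add: abs_mult)
  ultimately show ?thesis
    by (simp add: width_def[of "I * J"] uv(1) uv'(1))
qed

section \<open>The oracle of a real number\<close>

definition oracle_of_real :: "real \<Rightarrow> rule"
  where "oracle_of_real x = (\<lambda>A. x \<in>\<^sub>i real_interval A)"

text \<open>This makes the zero and one of \<open>oracle_ring\<close> the images of the reals 0 and
  1.\<close>

lemma oracle_of_rat_eq: "oracle_of_rat q = oracle_of_real (of_rat q)"
  by (simp add: oracle_of_rat_def oracle_of_real_def of_rat_mem_real_interval)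

lemma oracle_of_real_small:
  assumes "0 < d"
  obtains A where "oracle_of_real x A" "width (real_interval A) < d"
proof -
  obtain a b where a: "x - d/2 < of_rat a" "of_rat a < x" and b: "x < of_rat b" "of_rat b < x + d/2"
    using of_rat_dense[of "x - d/2" x] of_rat_dense[of x "x + d/2"] assms by auto
  then have "a < b"
    by (metis less_trans of_rat_less)
  then show thesis
    using a b by (intro that[of "between a b"])
      (auto simp: oracle_of_real_def mem_real_interval width_def)
qed

lemma oracle_of_real_inj:
  assumes "oracle_of_real x = oracle_of_real y"
  shows "x = y"
proof (rule ccontr)
  assume "x \<noteq> y"
  then obtain A where "oracle_of_real x A" "width (real_interval A) < \<bar>x - y\<bar>"
    using oracle_of_real_small[of "\<bar>x - y\<bar>" x] by auto
  moreover from this assms have "oracle_of_real y A"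
    by simp
  ultimately show False
    using abs_diff_le_width[of x "real_interval A" y] by (simp add: oracle_of_real_def)
qed

lemma is_oracle_oracle_of_real: "is_oracle (oracle_of_real x)"
  unfolding is_oracle_def
proof (intro conjI)
  show "\<exists>a b. oracle_of_real x (between a b)"
    using oracle_of_real_small[of 1 x] between_surj by (metis zero_less_one)
  show "\<forall>c. (\<forall>a b. oracle_of_real x (between a b) \<longrightarrow> c \<in>\<^sub>i between a b) \<longrightarrow>
      oracle_of_real x (between c c)"
  proof (intro allI impI)
    fix c assume c: "\<forall>a b. oracle_of_real x (between a b) \<longrightarrow> c \<in>\<^sub>i between a b"
    \<comment> \<open>Otherwise a Yes interval shorter than the distance from \<open>c\<close> to
      \<open>x\<close> would have to contain both.\<close>
    have "of_rat c = x"
    proof (rule ccontr)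
      assume "of_rat c \<noteq> x"
      then obtain A where A: "oracle_of_real x A" "width (real_interval A) < \<bar>of_rat c - x\<bar>"
        using oracle_of_real_small[of "\<bar>of_rat c - x\<bar>" x] by auto
      then have "of_rat c \<in>\<^sub>i real_interval A"
        using c between_surj[of A] by (auto simp: of_rat_mem_real_interval)
      then show False
        using A abs_diff_le_width[of "of_rat c" "real_interval A" x]
        by (simp add: oracle_of_real_def)
    qed
    then show "oracle_of_real x (between c c)"
      by (auto simp: oracle_of_real_def mem_real_interval)
  qed
  \<comment> \<open>If \<open>c\<close> differs from \<open>x\<close>, then \<open>x\<close> lies
    strictly on one side of \<open>c\<close>, hence in exactly one of the two pieces.\<close>
  show "\<forall>a b c. oracle_of_real x (between a b) \<longrightarrow> c \<in>\<^sub>i between a b \<longrightarrow> c \<noteq> a \<longrightarrow> c \<noteq> b \<longrightarrow>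
      oracle_of_real x (between c c) \<or>
      oracle_of_real x (between a c) \<noteq> oracle_of_real x (between c b)"
    by (auto simp: oracle_of_real_def mem_real_interval set_of_between min_def max_def
        split: if_splits)
  show "\<forall>c d. oracle_of_real x (between c c) \<longrightarrow> oracle_of_real x (between d d) \<longrightarrow> c = d"
    by (auto simp: oracle_of_real_def mem_real_interval dest: order_antisym)
  show "\<forall>a b c d. set_of (between a b) \<subseteq> set_of (between c d) \<longrightarrow>
      oracle_of_real x (between a b) \<longrightarrow> oracle_of_real x (between c d)"
  proof (intro allI impI)
    fix a b c d
    assume "set_of (between a b) \<subseteq> set_of (between c d)" and x: "oracle_of_real x (between a b)"
    then have "min c d \<le> min a b" "max a b \<le> max c d"
      by (auto simp: set_of_between)
    then have "real_of_rat (min c d) \<le> of_rat (min a b)" "real_of_rat (max a b) \<le> of_rat (max c d)"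
      by (simp_all only: of_rat_less_eq)
    with x show "oracle_of_real x (between c d)"
      by (simp add: oracle_of_real_def mem_real_interval)
  qed
qed

section \<open>Every oracle comes from a real number\<close>

context
  fixes R :: rule
  assumes R: "is_oracle R"
begin

text \<open>The order on intervals is inclusion, so this is Consistency freed from
  \<open>between\<close>.\<close>

lemma oracle_mono:
  assumes "R A" "A \<le> B"
  shows "R B"
proof -
  obtain a b c d where "A = between a b" "B = between c d"
    using between_surj by metis
  moreover have "set_of A \<subseteq> set_of B"
    using assms(2) by (auto simp: set_of_eq less_eq_interval_def)
  ultimately show ?thesis
    using R assms(1) unfolding is_oracle_def by blast
qed

lemma oracle_separating:
  assumes "R (between a b)" "a < c" "c < b"
  shows "R (between c c) \<or> R (between a c) \<noteq> R (between c b)"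
proof -
  have "c \<in>\<^sub>i between a b" "c \<noteq> a" "c \<noteq> b"
    using assms by (auto simp: set_of_between)
  then show ?thesis
    using R assms(1) unfolding is_oracle_def by blast
qed

lemma oracle_rooted:
  assumes "R (between c c)" "R (between d d)"
  shows "c = d"
  using R assms unfolding is_oracle_def by blast

lemma oracle_closed:
  assumes "\<And>A. R A \<Longrightarrow> c \<in>\<^sub>i A"
  shows "R (between c c)"
  using R assms unfolding is_oracle_def by blast

text \<open>If two Yes intervals were disjoint, then every rational strictly between them would be a root.\<close>

lemma oracle_lower_le_upper:
  assumes "R A" "R B"
  shows "lower A \<le> upper B"
proof (rule ccontr)
  assume "\<not> lower A \<le> upper B"
  \<comment> \<open>Two points of the gap are taken because only two distinct roots contradict
    Rooted.\<close>
  then obtain m n where mn: "upper B < m" "m < n" "n < lower A"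
    by (meson dense not_le)
  have root: "R (between c c)" if c: "upper B < c" "c < lower A" for c
  proof -
    have bounds: "lower B \<le> upper B" "upper B < c" "c < lower A" "lower A \<le> upper A"
        "lower B \<le> lower A" "upper B \<le> upper A"
      using c lower_le_upper[of A] lower_le_upper[of B] by linarith+
    \<comment> \<open>The hull is Yes, and cutting it at \<open>c\<close> leaves one piece
      containing \<open>B\<close> and one containing \<open>A\<close>. Both are Yes by Consistency,
      so Separating forces a root at \<open>c\<close>.\<close>
    have "R (between (lower B) (upper A))" "R (between (lower B) c)"
      using bounds by (auto intro!: oracle_mono[OF assms(2)] simp: less_eq_interval_def)
    moreover have "R (between c (upper A))"
      using bounds by (auto intro!: oracle_mono[OF assms(1)] simp: less_eq_interval_def)
    moreover have "lower B < c" "c < upper A"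
      using bounds by linarith+
    ultimately show ?thesis
      using oracle_separating by blast
  qed
  have "R (between m m)" "R (between n n)"
    using mn by (auto intro!: root)
  with mn show False
    using oracle_rooted by blast
qed

text \<open>Bisection: cutting a Yes interval at its midpoint, Separating makes one of the halves or
  the midpoint singleton Yes, so the width can be halved repeatedly.\<close>

lemma oracle_small:
  assumes "0 < q"
  obtains A where "R A" "width A < q"
proof -
  obtain B where B: "R B"
    using R unfolding is_oracle_def by blast
  have bisect: "\<exists>A. R A \<and> width A \<le> width B / 2 ^ n" for n
  proof (induction n)
    case 0
    then show ?case using B by auto
  next
    case (Suc n)
    then obtain A where A: "R A" "width A \<le> width B / 2 ^ n"
      by blast
    define a b c where abc: "a = lower A" "b = upper A" "c = (a + b) / 2"
    have "a \<le> b" "0 \<le> width B"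
      by (simp_all add: abc width_def)
    have A_eq: "A = between a b"
      using \<open>a \<le> b\<close> by (simp add: interval_eq_iff abc)
    show ?case
    \<comment> \<open>Separating needs a cut point other than the end points; a singleton already
      has width 0.\<close>
    proof (cases "a = b")
      case True
      then show ?thesis
        using A \<open>0 \<le> width B\<close> by (intro exI[of _ A]) (simp add: width_def abc)
    next
      case False
      then have less: "a < c" "c < b"
        using \<open>a \<le> b\<close> by (auto simp: abc(3))
      then obtain C where "R C" "C \<in> {between c c, between a c, between c b}"
        using oracle_separating[of a b c] A(1) A_eq by blast
      moreover from this less have "width C \<le> width A / 2"
        by (auto simp: width_def A_eq abc(3) field_simps)
      then have "width C \<le> width B / 2 ^ Suc n"
        using A(2) by simp
      ultimately show ?thesis
        by blast
    qed
  qed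
  obtain n where "width B / q < of_nat n"
    using reals_Archimedean2 by blast
  also have "of_nat n < (2 :: rat) ^ n"
    using of_nat_less_two_power by blast
  finally have "width B / 2 ^ n < q"
    using assms by (simp add: field_simps)
  with bisect[of n] show thesis
    using that by force
qed

text \<open>The real is the supremum of the lower ends of Yes intervals. Every upper end bounds
  these by \<open>oracle_lower_le_upper\<close>, so the supremum lies in every Yes interval.\<close>

lemma oracle_is_real: "\<exists>x. R = oracle_of_real x"
proof -
  define S where "S = {real_of_rat (lower A) | A. R A}"
  define x where "x = Sup S"
  obtain A\<^sub>0 where A0: "R A\<^sub>0"
    using oracle_small[of 1] by auto
  have bound: "s \<le> of_rat (upper B)" if "s \<in> S" "R B" for s B
    using that oracle_lower_le_upper by (auto simp: S_def of_rat_less_eq)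
  have mem: "x \<in>\<^sub>i real_interval A" if "R A" for A
  proof -
    have "of_rat (lower A) \<in> S"
      using that by (auto simp: S_def)
    moreover have "bdd_above S"
      using bound[OF _ A0] by (rule bdd_aboveI)
    ultimately have "of_rat (lower A) \<le> x"
      unfolding x_def by (rule cSup_upper)
    moreover have "x \<le> of_rat (upper A)"
      unfolding x_def
    proof (rule cSup_least)
      show "S \<noteq> {}"
        using A0 by (auto simp: S_def)
    qed (rule bound[OF _ that])
    ultimately show ?thesis
      by (simp add: mem_real_interval)
  qed
  \<comment> \<open>This covers the case of \<open>x\<close> being an end point of \<open>A\<close>,
    where a short Yes interval around \<open>x\<close> may stick out of \<open>A\<close>. Then
    \<open>x\<close> is rational and Closed applies.\<close>
  have root: "R A" if "x = of_rat c" "c \<in>\<^sub>i A" for c A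
  proof -
    have "R (between c c)"
      using mem that(1) by (intro oracle_closed) (simp add: of_rat_mem_real_interval)
    then show ?thesis
      using that(2) by (auto intro: oracle_mono simp: less_eq_interval_def set_of_eq)
  qed
  have "R A" if A: "x \<in>\<^sub>i real_interval A" for A
  proof (cases "x = of_rat (lower A) \<or> x = of_rat (upper A)")
    case True
    then show ?thesis
      using root by (auto simp: set_of_eq)
  next
    case False
    with A have "0 < min (x - of_rat (lower A)) (of_rat (upper A) - x)"
      by (auto simp: mem_real_interval)
    \<comment> \<open>A rational bound is chosen because \<open>oracle_small\<close> measures widths
      in the rationals. A Yes interval of smaller width contains \<open>x\<close>, so it cannot
      reach past either end of \<open>A\<close>.\<close>
    then obtain q where "0 < real_of_rat q" and
      q: "real_of_rat q < min (x - of_rat (lower A)) (of_rat (upper A) - x)"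
      using of_rat_dense by blast
    then obtain B where B: "R B" "width B < q"
      using oracle_small[of q] by auto
    have "real_of_rat (width B) < of_rat q"
      using B(2) by (simp add: of_rat_less)
    then have "real_of_rat (lower A) \<le> of_rat (lower B)" "real_of_rat (upper B) \<le> of_rat (upper A)"
      using q mem[OF B(1)] by (auto simp: width_def of_rat_diff mem_real_interval)
    then show ?thesis
      using B(1) by (auto intro: oracle_mono simp: less_eq_interval_def of_rat_less_eq)
  qed
  with mem show ?thesis
    by (auto simp: oracle_of_real_def)
qed

end

section \<open>Oracle arithmetic as real arithmetic\<close>

lemma is_oracle_iff: "is_oracle R \<longleftrightarrow> R \<in> range oracle_of_real"
  using oracle_is_real is_oracle_oracle_of_real by blast

text \<open>The common real makes the members intersect pairwise. For uniqueness, a competing oracle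
  belongs to some real \<open>y\<close>, and a member shorter than the distance from
  \<open>y\<close> to \<open>x\<close> cannot contain both.\<close>

lemma associated_oracle_eq:
  assumes mem: "\<And>A. A \<in> F \<Longrightarrow> oracle_of_real x A"
    and small: "\<And>d. 0 < d \<Longrightarrow> \<exists>A\<in>F. width (real_interval A) < d"
  shows "associated_oracle F = oracle_of_real x"
  unfolding associated_oracle_def
proof (rule the_equality)
  \<comment> \<open>The common point must be rational, so \<open>x\<close> itself may not
    serve.\<close>
  have "max (lower A) (lower B) \<in> set_of A \<inter> set_of B" if "A \<in> F" "B \<in> F" for A B
  proof -
    have "real_of_rat (lower A) \<le> of_rat (upper B)" "real_of_rat (lower B) \<le> of_rat (upper A)"
      using mem[OF that(1)] mem[OF that(2)] by (auto simp: oracle_of_real_def mem_real_interval)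
    then show ?thesis
      by (simp add: set_of_eq of_rat_less_eq)
  qed
  moreover have "\<exists>A\<in>F. width A < q" if "0 < q" for q
    using small[of "of_rat q"] that by (simp add: width_real_interval of_rat_less)
  ultimately have "is_fonsi F"
    unfolding is_fonsi_def by blast
  then show "is_fonsi F \<and> is_oracle (oracle_of_real x) \<and> (\<forall>A\<in>F. oracle_of_real x A)"
    using mem is_oracle_oracle_of_real by blast
next
  fix R assume R: "is_fonsi F \<and> is_oracle R \<and> (\<forall>A\<in>F. R A)"
  then obtain y where y: "R = oracle_of_real y"
    using oracle_is_real by blast
  have "y = x"
  proof (rule ccontr)
    assume "y \<noteq> x"
    then obtain A where "A \<in> F" "width (real_interval A) < \<bar>y - x\<bar>"
      using small[of "\<bar>y - x\<bar>"] by auto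
    then show False
      using R y mem[of A] abs_diff_le_width[of y "real_interval A" x]
      by (auto simp: oracle_of_real_def)
  qed
  with y show "R = oracle_of_real x"
    by simp
qed

lemma oracle_add_of_real: "oracle_add (oracle_of_real x) (oracle_of_real y) = oracle_of_real (x + y)"
  unfolding oracle_add_def
proof (rule associated_oracle_eq)
  fix d :: real assume "0 < d"
  then obtain A B where "oracle_of_real x A" "width (real_interval A) < d / 2"
    and "oracle_of_real y B" "width (real_interval B) < d / 2"
    using oracle_of_real_small[of "d / 2"] by (metis half_gt_zero)
  then show "\<exists>C\<in>{A + B |A B. oracle_of_real x A \<and> oracle_of_real y B}. width (real_interval C) < d"
    by (intro bexI[of _ "A + B"]) (auto simp: width_def of_rat_add)
qed (auto simp: oracle_of_real_def real_interval_plus intro: plus_in_intervalI)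

lemma oracle_mult_of_real: "oracle_mult (oracle_of_real x) (oracle_of_real y) = oracle_of_real (x * y)"
  unfolding oracle_mult_def
proof (rule associated_oracle_eq)
  fix d :: real assume d: "0 < d"
  \<comment> \<open>Widths below \<open>e\<close>, with \<open>e\<close> at most 1, turn the bound
    of \<open>width_times_le\<close> into \<open>(\<bar>x\<bar> + \<bar>y\<bar> + 2) * e\<close>.
    The 3 in place of 2 makes the final inequality strict.\<close>
  define e where "e = min 1 (d / (\<bar>x\<bar> + \<bar>y\<bar> + 3))"
  have pos: "0 < \<bar>x\<bar> + \<bar>y\<bar> + 3"
    by simp
  have e: "0 < e" "e \<le> 1"
    using d pos by (auto simp: e_def)
  have "e \<le> d / (\<bar>x\<bar> + \<bar>y\<bar> + 3)"
    by (simp add: e_def)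
  then have ed: "e * (\<bar>x\<bar> + \<bar>y\<bar> + 3) \<le> d"
    by (simp only: pos_le_divide_eq[OF pos])
  obtain A where A: "oracle_of_real x A" "width (real_interval A) < e"
    using e(1) by (rule oracle_of_real_small)
  obtain B where B: "oracle_of_real y B" "width (real_interval B) < e"
    using e(1) by (rule oracle_of_real_small)
  let ?v = "width (real_interval A)" and ?w = "width (real_interval B)"
  have "0 \<le> ?v" "0 \<le> ?w"
    by (simp_all add: width_def of_rat_less_eq)
  have "width (real_interval (A * B)) \<le> (\<bar>x\<bar> + ?v) * ?w + (\<bar>y\<bar> + ?w) * ?v"
    using A B by (simp add: real_interval_times oracle_of_real_def width_times_le)
  also have "\<dots> \<le> (\<bar>x\<bar> + 1) * e + (\<bar>y\<bar> + 1) * e"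
    using A B e \<open>0 \<le> ?v\<close> \<open>0 \<le> ?w\<close> by (intro add_mono mult_mono) auto
  also have "\<dots> < d"
    using e(1) ed by (simp add: algebra_simps)
  finally show "\<exists>C\<in>{A * B |A B. oracle_of_real x A \<and> oracle_of_real y B}. width (real_interval C) < d"
    using A B by blast
qed (auto simp: oracle_of_real_def real_interval_times intro: times_in_intervalI)

section \<open>Transfer of the field structure\<close>

lemma oracle_of_real_ring_iso: "oracle_of_real \<in> ring_iso ring_of_type_algebra oracle_ring"
proof (rule ring_iso_memI)
  show "bij_betw oracle_of_real (carrier ring_of_type_algebra) (carrier oracle_ring)"
    by (auto simp: bij_betw_def inj_on_def ring_of_type_algebra_def oracle_ring_def is_oracle_iff
        dest: oracle_of_real_inj)
qed (auto simp: ring_of_type_algebra_def oracle_ring_def is_oracle_iff oracle_add_of_real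
    oracle_mult_of_real oracle_of_rat_eq)

theorem theorem5p5:
  shows "field oracle_ring"
proof -
  \<comment> \<open>\<open>ring_iso\<close> does not ask that zero be preserved, so the transfer
    theorem speaks of the target ring with its zero replaced by the image of zero. Here the
    replacement changes nothing.\<close>
  have "oracle_ring\<lparr>zero := oracle_of_real \<zero>\<^bsub>ring_of_type_algebra\<^esub>\<rparr> = oracle_ring"
    by (simp add: ring_of_type_algebra_def oracle_ring_def oracle_of_rat_eq)
  then show ?thesis
    using field.ring_iso_imp_img_field[OF field_from_type_algebra oracle_of_real_ring_iso] by simp
qed

end
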